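(* Let $G$ be a connected simple graph with $n$ vertices and $m$ edges, with maximum vertex degree $\Delta(G)$ and minimum vertex degree $\delta(G)$, and let $q_1\ge q_2\ge\dots\ge q_n\ge 0$ be its signless Laplacian eigenvalues. For $1\le k\le n$ put $L_k(G)=\sum_{i=0}^{k-1} q_{n-i}$ (the sum of the $k$ smallest signless Laplacian eigenvalues). If $1\le k\le n-1$, then $$L_k(G)\ge \frac{2mk}{n}-\frac{\sqrt{k(n-k)\big(8mn+n^2(\Delta(G)-\delta(G))^2\big)}}{2n},$$ with equality if and only if $G\cong K_n$ and $k=n-1$. Moreover, for $k=n$ equality always holds (i.e. $L_n(G)=2m$).
   Context: The signless Laplacian matrix of $G$ is $Q(G)=D(G)+A(G)$, where $A(G)$ is the adjacency matrix and $D(G)$ the diagonal matrix of vertex degrees. $K_n$ is the complete graph on $n$ vertices. *)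

theory Defs
  imports "Graph_Theory.Graph_Theory" "Jordan_Normal_Form.Char_Poly"
begin

text \<open>
  A finite simple graph is a \<^locale>\<open>graph\<close> of the library: a finite, loop-free, symmetric digraph
  without parallel arcs. An undirected edge is thus a pair of opposite arcs, edges have to be
  counted as unordered pairs of end points, and the out-degree of a vertex is its number of
  neighbours.
\<close>

definition num_edges :: "('a, 'b) pre_digraph \<Rightarrow> nat" where
  "num_edges G = card ((\<lambda>e. {tail G e, head G e}) ` arcs G)"

definition max_degree :: "('a, 'b) pre_digraph \<Rightarrow> nat" where
  "max_degree G = Max (out_degree G ` verts G)"

definition min_degree :: "('a, 'b) pre_digraph \<Rightarrow> nat" where
  "min_degree G = Min (out_degree G ` verts G)"

text \<open>
  The matrices of a graph depend on an enumeration of its vertices, given here as a list \<open>vs\<close>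
  that is meant to contain every vertex exactly once.
\<close>

definition adjacency_mat :: "('a, 'b) pre_digraph \<Rightarrow> 'a list \<Rightarrow> real mat" where
  "adjacency_mat G vs =
     mat (length vs) (length vs) (\<lambda>(i, j). if vs ! i \<rightarrow>\<^bsub>G\<^esub> vs ! j then 1 else 0)"

definition degree_mat :: "('a, 'b) pre_digraph \<Rightarrow> 'a list \<Rightarrow> real mat" where
  "degree_mat G vs = mat_diag (length vs) (\<lambda>i. real (out_degree G (vs ! i)))"

definition signless_laplacian :: "('a, 'b) pre_digraph \<Rightarrow> 'a list \<Rightarrow> real mat" where
  "signless_laplacian G vs = degree_mat G vs + adjacency_mat G vs"

text \<open>
  \<open>signless_laplacian_eigenvalue G vs i\<close> is $q_i$ (counting from 1): the eigenvalues are the roots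
  of the characteristic polynomial, repeated according to multiplicity and listed in weakly
  decreasing order. As the matrix is real symmetric, there are \<open>length vs\<close> of them.
\<close>

definition signless_laplacian_eigenvalue :: "('a, 'b) pre_digraph \<Rightarrow> 'a list \<Rightarrow> nat \<Rightarrow> real" where
  "signless_laplacian_eigenvalue G vs i =
     rev (sorted_list_of_multiset (proots (char_poly (signless_laplacian G vs)))) ! (i - 1)"

definition sum_smallest_eigenvalues :: "('a, 'b) pre_digraph \<Rightarrow> 'a list \<Rightarrow> nat \<Rightarrow> real" where
  "sum_smallest_eigenvalues G vs k =
     (\<Sum>i<k. signless_laplacian_eigenvalue G vs (card (verts G) - i))"

end

theory Submission
  imports Defs "Jordan_Normal_Form.Schur_Decomposition" "Jordan_Normal_Form.Jordan_Normal_Form_Uniqueness"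
begin

text \<open>
  Schur triangularisation turns the first two power sums of the eigenvalues into the traces $2m$
  of $Q$ and $2m + \sum_v d_v^2$ of $Q^2$. Splitting the spectrum into the $k$ smallest and the $n - k$
  largest eigenvalues, Cauchy-Schwarz bounds $(2mk/n - L_k)^2$ by $k(n-k)/n^2$ times
  $n (2m + \sum_v d_v^2) - 4m^2$, and Popoviciu's inequality bounds the degree variance by
  $(\Delta - \delta)^2/4$.

  In case of equality the spectrum lies in a two-element set $\{a, b\}$, hence $(Q - a)(Q - b) = 0$.
  Then no two non-adjacent vertices have a common neighbour, so a connected $G$ is complete.
  For $K_n$, the identity $(Q - (n-2))(Q - (2n-2)) = 0$ and the trace determine the spectrum.
\<close>

section \<open>Traces and spectra of symmetric matrices\<close>

definition mat_trace :: "'a :: comm_ring_1 mat \<Rightarrow> 'a" where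
  "mat_trace A = (\<Sum>i<dim_row A. A $$ (i, i))"

lemma mult_mat_entry:
  assumes "A \<in> carrier_mat n m" "B \<in> carrier_mat m l" "i < n" "j < l"
  shows "(A * B) $$ (i, j) = (\<Sum>w<m. A $$ (i, w) * B $$ (w, j))"
  using assms by (auto simp: scalar_prod_def atLeast0LessThan intro!: sum.cong)

lemma mat_trace_mult_comm:
  assumes "A \<in> carrier_mat n m" "B \<in> carrier_mat m n"
  shows "mat_trace (A * B) = mat_trace (B * A)"
proof -
  have "mat_trace (A * B) = (\<Sum>i<n. \<Sum>w<m. A $$ (i, w) * B $$ (w, i))"
    using assms unfolding mat_trace_def by (auto simp del: index_mult_mat(1) simp: mult_mat_entry[OF assms])
  also have "\<dots> = (\<Sum>w<m. \<Sum>i<n. B $$ (w, i) * A $$ (i, w))"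
    by (subst sum.swap) (simp add: mult.commute)
  also have "\<dots> = mat_trace (B * A)"
    using assms unfolding mat_trace_def by (auto simp del: index_mult_mat(1) simp: mult_mat_entry[OF assms(2,1)])
  finally show ?thesis .
qed

lemma mat_trace_similar:
  assumes "similar_mat_wit A B P Q"
  shows "mat_trace A = mat_trace B"
proof -
  define n where "n = dim_row A"
  note w = similar_mat_witD[OF n_def assms]
  have "mat_trace A = mat_trace (Q * (P * B))"
    unfolding w(3) by (rule mat_trace_mult_comm[of _ n n]) (use w in auto)
  also have "Q * (P * B) = B"
    using w by (simp add: assoc_mult_mat[of Q n n P n B n, symmetric])
  finally show ?thesis .
qed

lemma mat_trace_mult_transpose:
  assumes "A \<in> carrier_mat n m"
  shows "mat_trace (A * transpose_mat A) = (\<Sum>i<n. \<Sum>j<m. (A $$ (i, j))\<^sup>2)"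
  using assms unfolding mat_trace_def
  by (auto simp del: index_mult_mat(1) simp: mult_mat_entry[of A n m _ n] power2_eq_square intro!: sum.cong)

text \<open>With the same pair \<open>P\<close>, \<open>Q\<close> on both sides, the inner factor
  \<open>Q * P\<close> cancels. Products of shifts of \<open>A\<close> are thus carried to the same
  products of shifts of its triangular form.\<close>

lemma similar_mat_wit_mult:
  assumes "similar_mat_wit A B P Q" "similar_mat_wit A' B' P Q"
  shows "similar_mat_wit (A * A') (B * B') P Q"
proof -
  define n where "n = dim_row A"
  note w = similar_mat_witD[OF n_def assms(1)]
  have "dim_row A' = n" using assms(2) w(6) unfolding similar_mat_wit_def Let_def by auto
  note w' = similar_mat_witD[OF this[symmetric] assms(2)]
  have "A * A' = P * B * (Q * (P * B' * Q))"
    unfolding w(3) w'(3) by (rule assoc_mult_mat[of _ n n _ n _ n]) (use w w' in auto)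
  also have "Q * (P * B' * Q) = Q * (P * B') * Q"
    using w w' by (intro assoc_mult_mat[of _ n n _ n _ n, symmetric]) auto
  also have "Q * (P * B') = B'"
    using w w' by (simp add: assoc_mult_mat[of Q n n P n B' n, symmetric])
  also have "P * B * (B' * Q) = P * (B * B') * Q"
    using w w' by (simp add: assoc_mult_mat[of _ n n _ n _ n])
  finally show ?thesis using w w' by (intro similar_mat_witI[of _ _ n]) auto
qed

text \<open>A summand \<open>A $$ (i, w) * B $$ (w, j)\<close> can be nonzero only for i \<le> w
  \<le> j. This range is empty below the diagonal and a single index on it.\<close>

lemma upper_triangular_mult:
  assumes "A \<in> carrier_mat n n" "B \<in> carrier_mat n n" "upper_triangular A" "upper_triangular B"
  shows "upper_triangular (A * B)"
    and "\<And>i. i < n \<Longrightarrow> (A * B) $$ (i, i) = A $$ (i, i) * B $$ (i, i)"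
proof -
  show "upper_triangular (A * B)"
  proof
    fix i j assume ij: "j < i" "i < dim_row (A * B)"
    then have "A $$ (i, w) * B $$ (w, j) = 0" if "w < n" for w
      using assms that upper_triangularD[OF assms(3), of w i] upper_triangularD[OF assms(4), of j w]
      by (cases "w < i") auto
    then show "(A * B) $$ (i, j) = 0"
      using ij assms by (subst mult_mat_entry[of A n n B n]) (auto intro!: sum.neutral)
  qed
  fix i assume i: "i < n"
  have "A $$ (i, w) * B $$ (w, i) = 0" if "w < n" "w \<noteq> i" for w
    using assms that i upper_triangularD[OF assms(3), of w i] upper_triangularD[OF assms(4), of i w]
    by (cases "w < i") auto
  then have "(\<Sum>w<n. A $$ (i, w) * B $$ (w, i)) = (\<Sum>w<n. if w = i then A $$ (i, i) * B $$ (i, i) else 0)"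
    by (intro sum.cong) auto
  then show "(A * B) $$ (i, i) = A $$ (i, i) * B $$ (i, i)"
    using i assms by (subst mult_mat_entry[of A n n B n]) auto
qed

lemma upper_triangular_char_matrix:
  assumes "A \<in> carrier_mat n n" "upper_triangular A"
  shows "upper_triangular (char_matrix A e)"
    and "\<And>i. i < n \<Longrightarrow> char_matrix A e $$ (i, i) = A $$ (i, i) - e"
  using assms upper_triangularD[OF assms(2)] unfolding char_matrix_def upper_triangular_def by auto

section \<open>Real spectrum and triangular form of a symmetric matrix\<close>

text \<open>Evaluate the Hermitian form \<open>s\<close> of \<open>A\<close> at an eigenvector
  \<open>v\<close>: it equals \<open>a\<close> times the squared norm \<open>N\<close>, and symmetry
  of \<open>A\<close> makes it its own conjugate. So \<open>a\<close> is a quotient of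
  reals.\<close>

lemma eigenvalue_symmetric_real:
  fixes A :: "real mat"
  assumes A: "A \<in> carrier_mat n n" and sym: "transpose_mat A = A"
    and ev: "eigenvalue (map_mat complex_of_real A) a"
  shows "a \<in> \<real>"
proof -
  obtain v where v: "v \<in> carrier_vec n" "v \<noteq> 0\<^sub>v n"
      and eq: "map_mat complex_of_real A *\<^sub>v v = a \<cdot>\<^sub>v v"
    using ev A unfolding eigenvalue_def eigenvector_def by auto
  have A_sym: "A $$ (i, j) = A $$ (j, i)" if "i < n" "j < n" for i j
    using A that arg_cong[OF sym, of "\<lambda>M. M $$ (i, j)"] by simp
  define s where "s = (\<Sum>i<n. \<Sum>j<n. complex_of_real (A $$ (i, j)) * (cnj (v $ i) * v $ j))"
  define N where "N = (\<Sum>i<n. (cmod (v $ i))\<^sup>2)"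
  have row: "(\<Sum>j<n. complex_of_real (A $$ (i, j)) * v $ j) = a * v $ i" if "i < n" for i
    using arg_cong[OF eq, of "\<lambda>u. u $ i"] that A v(1)
    by (auto simp: scalar_prod_def atLeast0LessThan)
  have "s = (\<Sum>i<n. cnj (v $ i) * (\<Sum>j<n. complex_of_real (A $$ (i, j)) * v $ j))"
    unfolding s_def by (simp add: sum_distrib_left mult_ac)
  also have "\<dots> = (\<Sum>i<n. cnj (v $ i) * (a * v $ i))"
    by (simp add: row)
  also have "\<dots> = (\<Sum>i<n. a * complex_of_real ((cmod (v $ i))\<^sup>2))"
    by (simp add: complex_norm_square mult_ac del: of_real_power)
  also have "\<dots> = a * complex_of_real N"
    unfolding N_def by (simp add: sum_distrib_left)
  finally have s: "s = a * complex_of_real N" .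
  have "cnj s = (\<Sum>i<n. \<Sum>j<n. complex_of_real (A $$ (i, j)) * (v $ i * cnj (v $ j)))"
    unfolding s_def by simp
  also have "\<dots> = s"
    unfolding s_def by (subst sum.swap) (auto intro!: sum.cong simp: A_sym mult_ac)
  finally have "s \<in> \<real>" by (simp add: Reals_cnj_iff)
  moreover have "N \<noteq> 0"
  proof
    assume "N = 0"
    then have "\<forall>i<n. v $ i = 0" unfolding N_def by (subst (asm) sum_nonneg_eq_0_iff) auto
    then show False using v by (auto intro!: eq_vecI)
  qed
  moreover from this have "a = s / complex_of_real N" using s by simp
  ultimately show ?thesis by (metis Reals_divide Reals_of_real)
qed

text \<open>Factor over the complex numbers, replace each root by its real part since it is real,
  and pull the factorization back along the injective embedding of real polynomials.\<close>

lemma symmetric_real_char_poly_splits: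
  fixes A :: "real mat"
  assumes A: "A \<in> carrier_mat n n" and sym: "transpose_mat A = A"
  shows "\<exists>es. char_poly A = (\<Prod>e\<leftarrow>es. [:- e, 1:])"
proof -
  let ?C = "map_mat complex_of_real A"
  have C: "?C \<in> carrier_mat n n" using A by simp
  obtain as where as: "char_poly ?C = (\<Prod>a\<leftarrow>as. [:- a, 1:])"
    using char_poly_factorized[OF C] by blast
  have real: "a \<in> \<real>" if "a \<in> set as" for a
  proof (rule eigenvalue_symmetric_real[OF A sym])
    have "poly (char_poly ?C) a = 0"
      unfolding as poly_prod_list using that by (auto simp: prod_list_zero_iff)
    then show "eigenvalue ?C a" using eigenvalue_root_char_poly[OF C] by blast
  qed
  interpret h: map_poly_inj_idom_hom complex_of_real ..
  have "map_poly complex_of_real (char_poly A) = char_poly ?C"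
    by (rule of_real_hom.char_poly_hom[OF A, symmetric])
  also have "\<dots> = (\<Prod>a\<leftarrow>as. map_poly complex_of_real [:- Re a, 1:])"
    unfolding as by (intro arg_cong[of _ _ prod_list] map_cong) (auto simp: real of_real_hom.hom_uminus)
  also have "\<dots> = map_poly complex_of_real (\<Prod>e\<leftarrow>map Re as. [:- e, 1:])"
    by (simp add: h.hom_prod_list o_def)
  finally show ?thesis using h.injectivity by blast
qed

text \<open>Schur decomposition accepts the roots in any prescribed order, so the diagonal of
  \<open>T\<close> can be the sorted list \<open>es\<close> itself; the length of \<open>es\<close>
  is then the dimension.\<close>

lemma symmetric_real_schur:
  fixes A :: "real mat"
  assumes A: "A \<in> carrier_mat n n" and sym: "transpose_mat A = A"
  defines "es \<equiv> sorted_list_of_multiset (proots (char_poly A))"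
  obtains T P Q where "similar_mat_wit A T P Q" "T \<in> carrier_mat n n" "upper_triangular T"
    "length es = n" "\<And>i. i < n \<Longrightarrow> T $$ (i, i) = es ! i"
proof -
  obtain fs where fs: "char_poly A = (\<Prod>e\<leftarrow>fs. [:- e, 1:])"
    using symmetric_real_char_poly_splits[OF A sym] by blast
  have "proots (char_poly A) = mset fs"
    unfolding fs
  proof (induction fs)
    case (Cons f fs)
    have "(\<Prod>e\<leftarrow>fs. [:- e, 1:]) \<noteq> 0" by (auto simp: prod_list_zero_iff)
    then have "proots ([:- f, 1:] * (\<Prod>e\<leftarrow>fs. [:- e, 1:])) = {#f#} + mset fs"
      using Cons by (subst proots_mult) auto
    then show ?case by simp
  qed simp
  then have "mset es = mset fs" unfolding es_def by simp
  then have "char_poly A = (\<Prod>e\<leftarrow>es. [:- e, 1:])"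
    unfolding fs by (metis mset_map prod_mset_prod_list)
  moreover obtain T P Q where "schur_decomposition A es = (T, P, Q)" by (metis prod_cases3)
  ultimately have T: "similar_mat_wit A T P Q" "upper_triangular T" "diag_mat T = es"
    using schur_decomposition[OF A] by blast+
  moreover have "T \<in> carrier_mat n n" using similar_mat_witD2[OF A T(1)] by blast
  ultimately show ?thesis using that[of T P Q] by (auto simp: diag_mat_def)
qed

text \<open>Each sum over \<open>es\<close> is a trace of a triangular matrix similar to
  \<open>A\<close>, to \<open>A * A\<close> or to \<open>M\<close> times its transpose, where
  \<open>M\<close> is \<open>char_matrix A a * char_matrix A b\<close>, that is (A - a)(A - b). The
  last trace is a sum of squared entries, so \<open>M\<close> vanishes once every eigenvalue is
  \<open>a\<close> or \<open>b\<close>.\<close>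

lemma symmetric_real_eigenvalue_sums:
  fixes A :: "real mat"
  assumes A: "A \<in> carrier_mat n n" and sym: "transpose_mat A = A"
  defines "es \<equiv> sorted_list_of_multiset (proots (char_poly A))"
  shows "length es = n"
    and "(\<Sum>i<n. es ! i) = (\<Sum>i<n. A $$ (i, i))"
    and "(\<Sum>i<n. (es ! i)\<^sup>2) = (\<Sum>i<n. \<Sum>j<n. (A $$ (i, j))\<^sup>2)"
    and "(\<Sum>i<n. ((es ! i - a) * (es ! i - b))\<^sup>2) =
      (\<Sum>i<n. \<Sum>j<n. ((char_matrix A a * char_matrix A b) $$ (i, j))\<^sup>2)"
proof -
  obtain T P Q where w: "similar_mat_wit A T P Q" and T: "T \<in> carrier_mat n n"
      and ut: "upper_triangular T" and len: "length es = n"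
      and diag: "\<And>i. i < n \<Longrightarrow> T $$ (i, i) = es ! i"
    using symmetric_real_schur[OF A sym] unfolding es_def by metis
  show "length es = n" by (rule len)
  show "(\<Sum>i<n. es ! i) = (\<Sum>i<n. A $$ (i, i))"
    using mat_trace_similar[OF w] A T diag unfolding mat_trace_def by auto
  have "(\<Sum>i<n. (es ! i)\<^sup>2) = mat_trace (T * T)"
    using T unfolding mat_trace_def
    by (auto simp del: index_mult_mat(1) simp: upper_triangular_mult(2)[OF T T ut ut] diag power2_eq_square)
  also have "\<dots> = mat_trace (A * transpose_mat A)"
    unfolding sym by (rule mat_trace_similar[OF similar_mat_wit_mult[OF w w], symmetric])
  finally show "(\<Sum>i<n. (es ! i)\<^sup>2) = (\<Sum>i<n. \<Sum>j<n. (A $$ (i, j))\<^sup>2)"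
    unfolding mat_trace_mult_transpose[OF A] .
  let ?A = "char_matrix A" and ?T = "char_matrix T"
  have cA: "?A e \<in> carrier_mat n n" and cT: "?T e \<in> carrier_mat n n" for e
    using A T by auto
  have sA: "transpose_mat (?A e) = ?A e" for e
  proof -
    have "A $$ (j, i) = A $$ (i, j)" if "i < n" "j < n" for i j
      using A that arg_cong[OF sym, of "\<lambda>M. M $$ (i, j)"] by simp
    then show ?thesis using A unfolding char_matrix_def by (intro eq_matI) auto
  qed
  note wc = similar_mat_wit_char_matrix[OF w]
  note uc = upper_triangular_char_matrix[OF T ut]
  let ?M = "?A a * ?A b" and ?S = "?T a * ?T b * (?T b * ?T a)"
  have sM: "transpose_mat ?M = ?A b * ?A a"
    by (subst transpose_mult[OF cA cA]) (simp add: sA)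
  have "?S $$ (i, i) = ((es ! i - a) * (es ! i - b))\<^sup>2" if "i < n" for i
  proof -
    note um = upper_triangular_mult[OF cT cT uc(1) uc(1)]
    have "?S $$ (i, i) = (?T a * ?T b) $$ (i, i) * (?T b * ?T a) $$ (i, i)"
      using that by (intro upper_triangular_mult(2)[of _ n] mult_carrier_mat[of _ n n _ n] cT um(1))
    then show ?thesis
      unfolding um(2)[OF that] uc(2)[OF that] diag[OF that] by (simp add: power2_eq_square)
  qed
  moreover have "dim_row ?S = n" using cT[of a] by auto
  ultimately have "(\<Sum>i<n. ((es ! i - a) * (es ! i - b))\<^sup>2) = mat_trace ?S"
    unfolding mat_trace_def by simp
  also have "\<dots> = mat_trace (?M * transpose_mat ?M)"
    unfolding sM
    by (rule mat_trace_similar[OF similar_mat_wit_mult[OF similar_mat_wit_mult[OF wc wc]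
          similar_mat_wit_mult[OF wc wc]], symmetric])
  finally show "(\<Sum>i<n. ((es ! i - a) * (es ! i - b))\<^sup>2) = (\<Sum>i<n. \<Sum>j<n. (?M $$ (i, j))\<^sup>2)"
    unfolding mat_trace_mult_transpose[OF mult_carrier_mat[OF cA cA]] .
qed

section \<open>Partial sums under a variance bound\<close>

lemma sum_power2_deviation:
  fixes e :: "'i \<Rightarrow> real"
  assumes "finite A" "A \<noteq> {}"
  shows "(\<Sum>i\<in>A. (e i - sum e A / real (card A))\<^sup>2) =
    (\<Sum>i\<in>A. (e i)\<^sup>2) - (sum e A)\<^sup>2 / real (card A)"
proof -
  define c where "c = real (card A)"
  have c: "c \<noteq> 0" using assms by (simp add: c_def)
  have "(\<Sum>i\<in>A. (e i - sum e A / c)\<^sup>2) =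
      (\<Sum>i\<in>A. (e i)\<^sup>2 - 2 * (sum e A / c) * e i + (sum e A / c)\<^sup>2)"
    by (intro sum.cong) (auto simp: power2_diff)
  also have "\<dots> = (\<Sum>i\<in>A. (e i)\<^sup>2) - 2 * (sum e A / c) * sum e A + c * (sum e A / c)\<^sup>2"
    by (simp add: sum.distrib sum_subtractf sum_distrib_left c_def)
  also have "\<dots> = (\<Sum>i\<in>A. (e i)\<^sup>2) - (sum e A)\<^sup>2 / c"
    using c by (simp add: power2_eq_square field_simps)
  finally show ?thesis by (simp add: c_def)
qed

text \<open>This is Cauchy-Schwarz for two blocks of sizes \<open>k\<close> and \<open>n - k\<close>
  with the defect kept: the defect is a positive multiple of the squared deviations from the two
  block means. Dropping it gives the bound; equality forces it to be 0, so \<open>e\<close> is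
  constant on each block.\<close>

lemma partial_sum_ge_of_variance:
  fixes e :: "nat \<Rightarrow> real" and W :: real
  assumes k: "0 < k" "k < n"
    and W: "4 * (real n * (\<Sum>i<n. (e i)\<^sup>2) - (\<Sum>i<n. e i)\<^sup>2) \<le> W"
  defines "B \<equiv> (\<Sum>i<n. e i) * real k / real n
    - sqrt (real k * (real n - real k) * W) / (2 * real n)"
  shows "B \<le> (\<Sum>i<k. e i)"
    and "(\<Sum>i<k. e i) = B \<Longrightarrow> \<exists>a b. \<forall>i<n. e i = a \<or> e i = b"
proof -
  define s S E where "s = (\<Sum>i<n. e i)" and "S = (\<Sum>i<k. e i)" and "E = (\<Sum>i<n. (e i)\<^sup>2)"
  define l where "l = real n - real k"
  \<comment> \<open>\<open>X\<close> is the shortfall of the partial sum against its proportional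
    share, \<open>a\<close> and \<open>b\<close> are the block means, and \<open>R\<close> is what
    the means contribute to the sum of squares.\<close>
  define X where "X = s * real k / real n - S"
  define a b where "a = S / real k" and "b = (s - S) / l"
  define R where "R = S\<^sup>2 / real k + (s - S)\<^sup>2 / l"
  have pos: "real k > 0" "l > 0" "real n > 0" and n: "real n = real k + l"
    using k by (auto simp: l_def)
  have split: "sum f {..<n} = sum f {..<k} + sum f {k..<n}" for f :: "nat \<Rightarrow> real"
    using k by (metis less_imp_le_nat atLeast0LessThan sum.atLeastLessThan_concat zero_le)
  have tail: "(\<Sum>i=k..<n. e i) = s - S" using split[of e] by (simp add: s_def S_def)
  have l: "l = real (card {k..<n})" using k by (simp add: l_def)
  have "(\<Sum>i<k. (e i - a)\<^sup>2) = (\<Sum>i<k. (e i)\<^sup>2) - S\<^sup>2 / real k"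
    using sum_power2_deviation[of "{..<k}" e] k by (auto simp: a_def S_def)
  moreover have "(\<Sum>i=k..<n. (e i - b)\<^sup>2) = (\<Sum>i=k..<n. (e i)\<^sup>2) - (s - S)\<^sup>2 / l"
    using sum_power2_deviation[of "{k..<n}" e] k unfolding tail l[symmetric] b_def by auto
  ultimately have dev: "(\<Sum>i<k. (e i - a)\<^sup>2) + (\<Sum>i=k..<n. (e i - b)\<^sup>2) =
      E - R"
    unfolding E_def R_def split by simp
  have nX: "real n * X = s * real k - real n * S"
    using pos unfolding X_def by (simp add: field_simps)
  have "real k * l * real n * R = real n * (l * S\<^sup>2 + real k * (s - S)\<^sup>2)"
    using pos(1,2) unfolding R_def by (simp add: distrib_left)
  \<comment> \<open>With x = S and y = s - S this is the Lagrange identity (k + l)(l x^2 + k y^2) =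
    k l (x + y)^2 + (k y - l x)^2.\<close>
  also have "\<dots> = real k * l * s\<^sup>2 + (s * real k - real n * S)\<^sup>2"
    unfolding n by (simp add: algebra_simps power2_eq_square)
  finally have "real k * l * real n * R = real k * l * s\<^sup>2 + (real n * X)\<^sup>2"
    unfolding nX .
  then have sq: "(2 * real n * X)\<^sup>2 = real k * l * (4 * (real n * E - s\<^sup>2)) -
      4 * (real k * l * real n) * ((\<Sum>i<k. (e i - a)\<^sup>2) + (\<Sum>i=k..<n. (e i - b)\<^sup>2))"
    unfolding dev by (simp add: algebra_simps power2_eq_square)
  have dev_nonneg: "(\<Sum>i<k. (e i - a)\<^sup>2) \<ge> 0" "(\<Sum>i=k..<n. (e i - b)\<^sup>2) \<ge> 0"
    by (auto intro: sum_nonneg)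
  have "real k * l * (4 * (real n * E - s\<^sup>2)) \<le> real k * l * W"
    using W pos by (intro mult_left_mono) (auto simp: E_def s_def)
  with sq have *: "(2 * real n * X)\<^sup>2 + 4 * (real k * l * real n) *
      ((\<Sum>i<k. (e i - a)\<^sup>2) + (\<Sum>i=k..<n. (e i - b)\<^sup>2)) \<le> real k * l * W"
    by simp
  have nonneg: "4 * (real k * l * real n) *
      ((\<Sum>i<k. (e i - a)\<^sup>2) + (\<Sum>i=k..<n. (e i - b)\<^sup>2)) \<ge> 0"
    using pos dev_nonneg by simp
  have "2 * real n * X \<le> sqrt (real k * l * W)"
    using * nonneg by (intro real_le_rsqrt) linarith
  then have "X \<le> sqrt (real k * l * W) / (2 * real n)"
    using pos by (simp add: field_simps)
  then show "B \<le> (\<Sum>i<k. e i)"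
    unfolding B_def X_def s_def S_def l_def by simp
  assume "(\<Sum>i<k. e i) = B"
  then have "X = sqrt (real k * l * W) / (2 * real n)"
    unfolding B_def X_def s_def S_def l_def by simp
  then have "2 * real n * X = sqrt (real k * l * W)"
    using pos by simp
  \<comment> \<open>Squaring the root returns the radicand only if the latter is
    nonnegative.\<close>
  moreover have "0 \<le> real k * l * W"
    using * nonneg by (smt (verit) zero_le_power2)
  ultimately have "(2 * real n * X)\<^sup>2 = real k * l * W" by simp
  with * have "4 * (real k * l * real n) *
      ((\<Sum>i<k. (e i - a)\<^sup>2) + (\<Sum>i=k..<n. (e i - b)\<^sup>2)) \<le> 0"
    by linarith
  then have "(\<Sum>i<k. (e i - a)\<^sup>2) + (\<Sum>i=k..<n. (e i - b)\<^sup>2) \<le> 0"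
    using pos by (simp add: mult_le_0_iff)
  then have "(\<Sum>i<k. (e i - a)\<^sup>2) = 0" "(\<Sum>i=k..<n. (e i - b)\<^sup>2) = 0"
    using dev_nonneg by linarith+
  then have "\<forall>i<k. e i = a" "\<forall>i\<in>{k..<n}. e i = b"
    by (simp_all add: sum_nonneg_eq_0_iff)
  then show "\<exists>a b. \<forall>i<n. e i = a \<or> e i = b"
    by (meson atLeastLessThan_iff not_less)
qed

text \<open>Sum (q - d)(d - p) \<ge> 0 over \<open>A\<close> and multiply by 4
  \<open>card A\<close>; adding the square of \<open>2 * sum d A - card A * (p + q)\<close> yields
  exactly the difference of the two sides.\<close>

lemma popoviciu_inequality:
  fixes d :: "'i \<Rightarrow> real"
  assumes "\<And>i. i \<in> A \<Longrightarrow> p \<le> d i \<and> d i \<le> q"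
  shows "4 * (real (card A) * (\<Sum>i\<in>A. (d i)\<^sup>2) - (sum d A)\<^sup>2) \<le> (real (card A))\<^sup>2 * (q - p)\<^sup>2"
proof -
  define c where "c = real (card A)"
  have "0 \<le> (\<Sum>i\<in>A. (q - d i) * (d i - p))"
    using assms by (intro sum_nonneg) auto
  also have "\<dots> = (\<Sum>i\<in>A. (p + q) * d i - (d i)\<^sup>2 - p * q)"
    by (intro sum.cong) (auto simp: algebra_simps power2_eq_square)
  also have "\<dots> = (p + q) * sum d A - (\<Sum>i\<in>A. (d i)\<^sup>2) - c * (p * q)"
    by (simp add: sum_subtractf sum_distrib_left c_def)
  finally have "0 \<le> 4 * c * ((p + q) * sum d A - (\<Sum>i\<in>A. (d i)\<^sup>2) - c * (p * q))"
    by (simp add: c_def)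
  moreover have "0 \<le> (2 * sum d A - c * (p + q))\<^sup>2" by simp
  ultimately show ?thesis
    unfolding c_def[symmetric] by (simp add: power2_eq_square algebra_simps)
qed

section \<open>Signless Laplacians of finite simple graphs\<close>

text \<open>Handshake lemma: arcs are counted once by their tails and once by their unordered end
  points. Each fibre of the second count is a pair of opposite arcs.\<close>

lemma (in graph) sum_out_degree: "(\<Sum>v\<in>verts G. out_degree G v) = 2 * num_edges G"
proof -
  let ?f = "\<lambda>e. {tail G e, head G e}"
  have "(\<Sum>v\<in>verts G. out_degree G v) = (\<Sum>v\<in>verts G. \<Sum>e\<in>{e \<in> arcs G. tail G e = v}. 1)"
    by (simp add: out_degree_def out_arcs_def)
  also have "\<dots> = card (arcs G)"
    by (subst sum.group) auto
  also have "\<dots> = (\<Sum>X\<in>?f ` arcs G. \<Sum>e\<in>{e \<in> arcs G. ?f e = X}. 1)"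
    by (subst sum.group) auto
  also have "\<dots> = (\<Sum>X\<in>?f ` arcs G. 2)"
  proof (intro sum.cong refl)
    fix X assume "X \<in> ?f ` arcs G"
    then obtain e where e: "e \<in> arcs G" "X = ?f e" by auto
    obtain e' where e': "e' \<in> arcs G" "tail G e = head G e'" "head G e = tail G e'"
      using sym_arcs e(1) unfolding symmetric_conv by blast
    have "e \<noteq> e'" using no_loops[OF e(1)] e' by auto
    moreover have "{x \<in> arcs G. ?f x = X} = {e, e'}"
      using e e' by (auto simp: doubleton_eq_iff arc_to_ends_def intro: no_multi_arcs)
    ultimately show "(\<Sum>e\<in>{e \<in> arcs G. ?f e = X}. 1) = (2::nat)" by simp
  qed
  finally show ?thesis by (simp add: num_edges_def)
qed

lemma (in nomulti_digraph) out_degree_eq_card_successors: "out_degree G u = card {v. u \<rightarrow> v}"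
proof -
  have "inj_on (head G) (out_arcs G u)"
    by (auto intro!: inj_onI no_multi_arcs simp: arc_to_ends_def)
  moreover have "head G ` out_arcs G u = {v. u \<rightarrow> v}"
    by (auto simp: arcs_ends_conv)
  ultimately show ?thesis unfolding out_degree_def by (metis card_image)
qed

text \<open>Induction along a walk from \<open>u\<close> replaces its initial part by a single arc.
  The alternative \<open>u = v\<close> in the induction covers walks that return to their
  start.\<close>

lemma (in graph) complete_if_connected_and_adj_trans:
  assumes "Digraph_Component.connected G"
    and trans: "\<And>u w v. u \<rightarrow> w \<Longrightarrow> w \<rightarrow> v \<Longrightarrow> u \<noteq> v \<Longrightarrow> u \<rightarrow> v"
  shows "complete_digraph (card (verts G)) G"
proof -
  have adj: "u \<rightarrow> v" if "u \<in> verts G" "v \<in> verts G" "u \<noteq> v" for u v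
  proof -
    have "u \<rightarrow>\<^sup>* v"
      using assms(1) that reachable_mk_symmetric_eq[OF sym_arcs]
      unfolding connected_def strongly_connected_def by auto
    then have "u = v \<or> u \<rightarrow> v"
      by (induction rule: reachable_induct) (auto intro: trans)
    then show ?thesis using that by simp
  qed
  have "u \<rightarrow> v \<longleftrightarrow> u \<in> verts G \<and> v \<in> verts G \<and> u \<noteq> v" for u v
    using adj adj_in_verts[of u v] adj_not_same[of u] by blast
  then have "arcs_ends G = {(u, v). (u, v) \<in> verts G \<times> verts G \<and> u \<noteq> v}"
    by auto
  then show ?thesis unfolding complete_digraph_def using graph_axioms by simp
qed

section \<open>Spectral sums of an enumerated graph\<close>

locale enumerated_graph = graph G for G (structure) +
  fixes vs :: "'a list"
  assumes distinct_vs: "distinct vs" and set_vs: "set vs = verts G"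
begin

abbreviation "n \<equiv> length vs"
abbreviation "deg i \<equiv> real (out_degree G (vs ! i))"
abbreviation "Q \<equiv> signless_laplacian G vs"
abbreviation "eigs \<equiv> sorted_list_of_multiset (proots (char_poly Q))"

lemma length_vs: "n = card (verts G)"
  using distinct_vs set_vs by (metis distinct_card)

lemma sum_vs: "(\<Sum>i<n. f (vs ! i)) = (\<Sum>v\<in>verts G. f v)"
  by (rule sum.reindex_bij_betw) (use bij_betw_nth[OF distinct_vs refl] set_vs in simp)

lemma Q_carrier: "Q \<in> carrier_mat n n"
  unfolding signless_laplacian_def degree_mat_def adjacency_mat_def mat_diag_def by simp

lemma Q_entry:
  assumes "i < n" "j < n"
  shows "Q $$ (i, j) = (if i = j then deg i else if vs ! i \<rightarrow> vs ! j then 1 else 0)"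
  using assms adj_not_same
  unfolding signless_laplacian_def degree_mat_def adjacency_mat_def mat_diag_def by auto

lemma Q_symmetric: "transpose_mat Q = Q"
  using Q_carrier arcs_ends_symmetric[OF sym_arcs] by (intro eq_matI) (auto simp: Q_entry)

lemma sum_deg: "(\<Sum>i<n. deg i) = 2 * real (num_edges G)"
  using arg_cong[OF sum_out_degree, of real] sum_vs[of "\<lambda>v. real (out_degree G v)"] by simp

lemma sum_adjacent:
  assumes "i < n"
  shows "(\<Sum>j<n. if vs ! i \<rightarrow> vs ! j then 1 else 0) = deg i"
proof -
  have "{v. vs ! i \<rightarrow> v} = verts G \<inter> {v. vs ! i \<rightarrow> v}" using adj_in_verts by auto
  then show ?thesis
    unfolding sum_vs[of "\<lambda>v. if vs ! i \<rightarrow> v then 1 else 0"] out_degree_eq_card_successors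
    by (simp add: sum.If_cases)
qed

text \<open>Off-diagonal entries are 0 or 1 and so equal their squares; row \<open>i\<close>
  therefore contributes its squared degree plus its degree.\<close>

lemma sum_Q_squares:
  "(\<Sum>i<n. \<Sum>j<n. (Q $$ (i, j))\<^sup>2) = (\<Sum>i<n. (deg i)\<^sup>2) + 2 * real (num_edges G)"
proof -
  have "(\<Sum>j<n. (Q $$ (i, j))\<^sup>2) = (deg i)\<^sup>2 + deg i" if "i < n" for i
  proof -
    have "(\<Sum>j<n. (Q $$ (i, j))\<^sup>2) =
        (\<Sum>j<n. (if j = i then (deg i)\<^sup>2 else 0) + (if vs ! i \<rightarrow> vs ! j then 1 else 0))"
      using that adj_not_same by (intro sum.cong) (auto simp: Q_entry)
    then show ?thesis using that by (simp add: sum.distrib sum_adjacent)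
  qed
  then show ?thesis by (simp add: sum.distrib sum_deg)
qed

lemma length_eigs: "length eigs = n"
  and sum_eigs: "(\<Sum>i<n. eigs ! i) = 2 * real (num_edges G)"
  and sum_eigs_squares:
    "(\<Sum>i<n. (eigs ! i)\<^sup>2) = (\<Sum>i<n. (deg i)\<^sup>2) + 2 * real (num_edges G)"
  and sum_eigs_quadratic: "(\<Sum>i<n. ((eigs ! i - a) * (eigs ! i - b))\<^sup>2) =
      (\<Sum>i<n. \<Sum>j<n. ((char_matrix Q a * char_matrix Q b) $$ (i, j))\<^sup>2)"
  using symmetric_real_eigenvalue_sums[OF Q_carrier Q_symmetric] sum_Q_squares
  by (simp_all add: Q_entry sum_deg)

text \<open>q_(n-i) has index n - i - 1 in the decreasing list, which is index \<open>i\<close> in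
  the increasing list \<open>eigs\<close>.\<close>

lemma sum_smallest_eq:
  assumes "k \<le> n"
  shows "sum_smallest_eigenvalues G vs k = (\<Sum>i<k. eigs ! i)"
  unfolding sum_smallest_eigenvalues_def signless_laplacian_eigenvalue_def length_vs[symmetric]
  using assms by (intro sum.cong) (auto simp: rev_nth length_eigs)

lemma degree_bounds:
  assumes "i < n"
  shows "real (min_degree G) \<le> deg i \<and> deg i \<le> real (max_degree G)"
proof -
  have "vs ! i \<in> verts G" using assms set_vs by (metis nth_mem)
  then show ?thesis unfolding min_degree_def max_degree_def by simp
qed

text \<open>Eigenvalues and degrees have the same sum, while their sums of squares differ by 2m. The
  left side is thus the same expression for the degrees plus 8mn, and Popoviciu's inequality applies
  to the degrees.\<close>

lemma eigs_variance:
  "4 * (real n * (\<Sum>i<n. (eigs ! i)\<^sup>2) - (\<Sum>i<n. eigs ! i)\<^sup>2) \<le>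
    8 * real (num_edges G) * real n +
    (real n)\<^sup>2 * (real (max_degree G) - real (min_degree G))\<^sup>2"
  using popoviciu_inequality[of "{..<n}" "real (min_degree G)" deg "real (max_degree G)"] degree_bounds
  unfolding sum_eigs sum_eigs_squares sum_deg by (simp add: algebra_simps)

text \<open>
  Off the diagonal, an entry of \<open>(Q - a)(Q - b)\<close> at a non-adjacent pair counts common neighbours.
\<close>
lemma complete_if_two_eigenvalues:
  assumes "Digraph_Component.connected G"
    and two: "\<And>i. i < n \<Longrightarrow> eigs ! i = a \<or> eigs ! i = b"
  shows "complete_digraph n G"
  unfolding length_vs
proof (rule complete_if_connected_and_adj_trans[OF assms(1)], rule ccontr)
  fix u w v
  assume uw: "u \<rightarrow> w" and wv: "w \<rightarrow> v" and uv: "u \<noteq> v" "\<not> u \<rightarrow> v"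
  let ?M = "char_matrix Q a * char_matrix Q b"
  obtain i l j where idx: "i < n" "u = vs ! i" "l < n" "w = vs ! l" "j < n" "v = vs ! j"
    using adj_in_verts[OF uw] adj_in_verts[OF wv] unfolding set_vs[symmetric] in_set_conv_nth
    by metis
  have ne: "i \<noteq> l" "l \<noteq> j" "i \<noteq> j"
    using idx uw wv uv adj_not_same by auto
  have entry: "char_matrix Q c $$ (x, y) = Q $$ (x, y) - (if x = y then c else 0)"
    if "x < n" "y < n" for c x y
    using that Q_carrier unfolding char_matrix_def by auto
  have c: "char_matrix Q c \<in> carrier_mat n n" for c
    using Q_carrier by simp
  have "(\<Sum>i<n. \<Sum>j<n. (?M $$ (i, j))\<^sup>2) = 0"
    unfolding sum_eigs_quadratic[symmetric] using two by (intro sum.neutral) auto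
  then have "(\<Sum>j<n. (?M $$ (i, j))\<^sup>2) = 0"
    using idx by (subst (asm) sum_nonneg_eq_0_iff) (auto intro: sum_nonneg)
  then have "?M $$ (i, j) = 0"
    using idx by (subst (asm) sum_nonneg_eq_0_iff) auto
  then have "(\<Sum>y<n. char_matrix Q a $$ (i, y) * char_matrix Q b $$ (y, j)) = 0"
    unfolding mult_mat_entry[OF c c idx(1,5)] .
  \<comment> \<open>The shifts enter only at \<open>y = i\<close> and \<open>y = j\<close>, where
    the other factor is 0 because \<open>u\<close> and \<open>v\<close> are distinct and
    non-adjacent. All other terms are products of 0/1 entries, and \<open>y = l\<close> gives
    1.\<close>
  moreover have "char_matrix Q a $$ (i, y) * char_matrix Q b $$ (y, j) \<ge> 0" if "y < n" for y
    using that idx ne uv by (auto simp: entry Q_entry)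
  ultimately have "char_matrix Q a $$ (i, l) * char_matrix Q b $$ (l, j) = 0"
    using idx by (subst (asm) sum_nonneg_eq_0_iff) auto
  then show False using idx ne uw wv by (auto simp: entry Q_entry)
qed

section \<open>Spectrum and equality case of complete graphs\<close>

context
  assumes complete: "complete_digraph n G" and n2: "n \<ge> 2"
begin

lemma complete_adjacent:
  assumes "i < n" "j < n"
  shows "vs ! i \<rightarrow> vs ! j \<longleftrightarrow> i \<noteq> j"
proof -
  have "vs ! i \<in> verts G" "vs ! j \<in> verts G" using assms set_vs by (metis nth_mem)+
  then show ?thesis
    using complete assms distinct_vs unfolding complete_digraph_def by (auto simp: nth_eq_iff_index_eq)
qed

lemma complete_deg:
  assumes "i < n"
  shows "deg i = real n - 1"
proof -
  have "deg i = (\<Sum>j<n. 1 - (if j = i then 1 else 0))"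
    unfolding sum_adjacent[OF assms, symmetric] using assms
    by (intro sum.cong) (auto simp: complete_adjacent)
  then show ?thesis using assms by (simp add: sum_subtractf)
qed

lemma complete_num_edges: "2 * real (num_edges G) = real n * (real n - 1)"
  unfolding sum_deg[symmetric] by (simp add: complete_deg)

lemma complete_max_min_degree: "max_degree G = min_degree G"
proof -
  have "out_degree G v = n - 1" if "v \<in> verts G" for v
  proof -
    obtain i where "i < n" "v = vs ! i" using \<open>v \<in> verts G\<close> set_vs by (metis in_set_conv_nth)
    then have "real (out_degree G v) = real (n - 1)" using complete_deg[of i] n2 by simp
    then show ?thesis by (simp only: of_nat_eq_iff)
  qed
  moreover have "verts G \<noteq> {}" using n2 set_vs by auto
  ultimately have "out_degree G ` verts G = {n - 1}" by auto
  then show ?thesis unfolding max_degree_def min_degree_def by simp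
qed

text \<open>For the all-ones matrix J, the two shifted matrices are J and J - nI, whose product is 0
  since J^2 = nJ.\<close>

lemma complete_eigs:
  assumes "i < n"
  shows "eigs ! i = real n - 2 \<or> eigs ! i = 2 * real n - 2"
proof -
  let ?a = "real n - 2" and ?b = "2 * real n - 2"
  have c: "char_matrix Q x \<in> carrier_mat n n" for x
    using Q_carrier by simp
  have entry: "char_matrix Q ?a $$ (x, y) = 1"
    "char_matrix Q ?b $$ (x, y) = 1 - (if x = y then real n else 0)" if "x < n" "y < n" for x y
    using that Q_carrier unfolding char_matrix_def by (auto simp: Q_entry complete_deg complete_adjacent)
  have "(char_matrix Q ?a * char_matrix Q ?b) $$ (x, y) = 0" if "x < n" "y < n" for x y
    unfolding mult_mat_entry[OF c c that] using that by (simp add: entry sum_subtractf)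
  then have "(\<Sum>i<n. ((eigs ! i - ?a) * (eigs ! i - ?b))\<^sup>2) = 0"
    unfolding sum_eigs_quadratic by simp
  then show ?thesis
    using assms by (subst (asm) sum_nonneg_eq_0_iff) auto
qed

text \<open>If the largest eigenvalue were n - 2, all would be, and the trace n(n - 1) would be too
  large. So it is 2n - 2, and the remaining n - 1 eigenvalues, each at least n - 2, sum to (n - 1)(n
  - 2).\<close>

lemma complete_eigs_init:
  assumes "i < n - 1"
  shows "eigs ! i = real n - 2"
proof -
  obtain l where l: "n = Suc l" using n2 by (cases n) auto
  have last: "eigs ! l = 2 * real n - 2"
  proof (rule ccontr)
    assume *: "eigs ! l \<noteq> 2 * real n - 2"
    have "eigs ! i = real n - 2" if "i < n" for i
    proof -
      have "eigs ! i \<le> eigs ! l"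
        using that l length_eigs by (intro sorted_nth_mono) auto
      then show ?thesis using complete_eigs[OF that] complete_eigs[of l] * l by auto
    qed
    then have "(\<Sum>i<n. eigs ! i) = real n * (real n - 2)" by simp
    then show False unfolding sum_eigs complete_num_edges using n2 by simp
  qed
  have "(\<Sum>i<l. eigs ! i - (real n - 2)) = 0"
    using sum_eigs complete_num_edges last unfolding l
    by (simp add: sum_subtractf algebra_simps)
  moreover have "eigs ! i - (real n - 2) \<ge> 0" if "i < l" for i
    using complete_eigs[of i] that l by auto
  ultimately show ?thesis
    using assms l by (subst (asm) sum_nonneg_eq_0_iff) auto
qed

text \<open>The sum is k(n - 2) and the bound is k(n - 1) minus the root of k(n - k)(n - 1). They
  agree iff that root is \<open>k\<close>; squaring and cancelling \<open>k\<close> leaves n(k - (n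
  - 1)) = 0.\<close>

lemma complete_bound_eq_iff:
  assumes "1 \<le> k" "k \<le> n - 1"
  shows "sum_smallest_eigenvalues G vs k = 2 * real (num_edges G) * real k / real n -
      sqrt (real k * (real n - real k) * (8 * real (num_edges G) * real n +
        (real n)\<^sup>2 * (real (max_degree G) - real (min_degree G))\<^sup>2)) / (2 * real n) \<longleftrightarrow>
    k = n - 1"
proof -
  have "vs \<noteq> []" using n2 by auto
  have "sum_smallest_eigenvalues G vs k = real k * (real n - 2)"
    using assms by (subst sum_smallest_eq) (auto simp: complete_eigs_init)
  moreover have edges: "8 * real (num_edges G) = 4 * (real n * (real n - 1))"
    using complete_num_edges by simp
  have radicand: "real k * (real n - real k) * (8 * real (num_edges G) * real n +
        (real n)\<^sup>2 * (real (max_degree G) - real (min_degree G))\<^sup>2) =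
      (2 * real n)\<^sup>2 * (real k * (real n - real k) * (real n - 1))"
    unfolding edges by (simp add: complete_max_min_degree power2_eq_square)
  have "sqrt (real k * (real n - real k) * (8 * real (num_edges G) * real n +
        (real n)\<^sup>2 * (real (max_degree G) - real (min_degree G))\<^sup>2)) / (2 * real n) =
      sqrt (real k * (real n - real k) * (real n - 1))"
    unfolding radicand using \<open>vs \<noteq> []\<close> by (simp add: real_sqrt_mult)
  moreover have "2 * real (num_edges G) * real k / real n = real k * (real n - 1)"
    unfolding complete_num_edges using \<open>vs \<noteq> []\<close> by simp
  \<comment> \<open>\<open>?thesis\<close> is itself an equivalence; only its left side is rewritten
    here.\<close>
  ultimately have "?thesis \<longleftrightarrow>
      (sqrt (real k * (real n - real k) * (real n - 1)) = real k \<longleftrightarrow> k = n - 1)"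
    by (auto simp: algebra_simps)
  moreover have "sqrt (real k * (real n - real k) * (real n - 1)) = real k \<longleftrightarrow>
      real k * (real n - real k) * (real n - 1) = (real k)\<^sup>2"
    using assms n2 by (subst real_sqrt_eq_iff[of _ "(real k)\<^sup>2", symmetric]) simp
  moreover have "\<dots> \<longleftrightarrow> real n * (real k - (real n - 1)) = 0"
  proof -
    have "real k * (real n - real k) * (real n - 1) - (real k)\<^sup>2 =
        - real k * (real n * (real k - (real n - 1)))"
      by (simp add: algebra_simps power2_eq_square)
    then show ?thesis using assms by auto
  qed
  moreover have "\<dots> \<longleftrightarrow> k = n - 1"
    using n2 by (auto simp: of_nat_diff)
  ultimately show ?thesis by blast
qed

end

end

theorem theorem2:
  fixes G :: "('a, 'b) pre_digraph" and vs :: "'a list" and n m :: nat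
    and bound :: "nat \<Rightarrow> real"
  defines "n \<equiv> card (verts G)" and "m \<equiv> num_edges G"
    and "bound \<equiv> \<lambda>k. 2 * real m * real k / real n -
           sqrt (real k * (real n - real k) *
             (8 * real m * real n +
              (real n)\<^sup>2 * (real (max_degree G) - real (min_degree G))\<^sup>2)) / (2 * real n)"
  assumes "graph G" and "Digraph_Component.connected G"
    and "distinct vs" and "set vs = verts G"
  shows "(\<forall>k. 1 \<le> k \<and> k \<le> n - 1 \<longrightarrow>
            sum_smallest_eigenvalues G vs k \<ge> bound k \<and>
            (sum_smallest_eigenvalues G vs k = bound k \<longleftrightarrow> complete_digraph n G \<and> k = n - 1)) \<and>
         sum_smallest_eigenvalues G vs n = bound n \<and>
         sum_smallest_eigenvalues G vs n = 2 * real m"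
proof -
  interpret enumerated_graph G vs
    using assms by (simp add: enumerated_graph_def enumerated_graph_axioms_def)
  have n: "n = length vs" by (simp add: n_def length_vs)
  \<comment> \<open>Connectedness includes having a vertex, so the division by \<open>n\<close> in
    \<open>bound n\<close> is genuine.\<close>
  have "verts G \<noteq> {}"
    using \<open>Digraph_Component.connected G\<close> unfolding connected_def strongly_connected_def by simp
  then have "n > 0" using finite_verts unfolding n_def by (simp add: card_gt_0_iff)
  have total: "sum_smallest_eigenvalues G vs n = 2 * real m"
    unfolding n m_def by (simp add: sum_smallest_eq sum_eigs)
  have bound: "bound k \<le> sum_smallest_eigenvalues G vs k \<and>
      (sum_smallest_eigenvalues G vs k = bound k \<longleftrightarrow> complete_digraph n G \<and> k = n - 1)"
    if k: "1 \<le> k" "k \<le> n - 1" for k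
  proof -
    \<comment> \<open>Since \<open>n - 1\<close> is truncated subtraction, \<open>1 \<le> k\<close>
      and \<open>k \<le> n - 1\<close> together give both \<open>k < n\<close> and
      \<open>n \<ge> 2\<close>.\<close>
    have kn: "0 < k" "k < length vs" "k \<le> length vs" "length vs \<ge> 2" using k n by auto
    note ps = partial_sum_ge_of_variance[OF kn(1,2) eigs_variance,
        unfolded sum_eigs, folded sum_smallest_eq[OF kn(3)] n m_def bound_def]
    have "complete_digraph n G" if "sum_smallest_eigenvalues G vs k = bound k"
      using ps(2) that complete_if_two_eigenvalues[OF assms(5)] unfolding bound_def n by blast
    moreover have "sum_smallest_eigenvalues G vs k = bound k \<longleftrightarrow> k = n - 1"
      if "complete_digraph n G"
      using complete_bound_eq_iff[of k] that k kn unfolding bound_def n m_def by blast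
    ultimately show ?thesis using ps(1) unfolding bound_def by blast
  qed
  \<comment> \<open>At \<open>k = n\<close> the factor n - k makes the radicand 0, and
    \<open>bound n\<close> reduces to 2m.\<close>
  show ?thesis
    using bound total \<open>n > 0\<close> by (auto simp: bound_def)
qed

end
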